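(* If $G$ is a looped simple graph with connected components $G_1,\dots,G_c$, then $M(IAS(G))=\bigoplus_{i=1}^c M(IAS(G_i))$. Moreover, $M(IAS(G_i))$ is a connected matroid unless $|V(G_i)|=1$, in which case $M(IAS(G_i))$ has two components, a loop and a pair of parallel non-loops.
   Context: A looped simple graph is a finite graph in which each vertex may carry at most one loop and distinct non-loop edges join distinct pairs of vertices. $A(G)$ is the adjacency matrix over $GF(2)$ (diagonal $1$ iff looped). $M(IAS(G))$ is the binary matroid represented by the columns of $(I\mid A(G)\mid I+A(G))$; its ground set $W(G)$ consists of three columns $v_\phi,v_\chi,v_\psi$ for each vertex $v$ (the columns of $v$ in $I$, $A(G)$, $I+A(G)$); $W(G_i)$ is identified with the subset of $W(G)$ of columns belonging to vertices of $G_i$. *)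

theory Defs
  imports
    "HOL-Library.Z2"
    "HOL-Library.Disjoint_Sets"
    "HOL-Library.Function_Algebras"
    "Graph_Theory.Digraph_Component"
begin

section \<open>Finite matroids\<close>

record 'e matroid_data =
  ground :: "'e set"
  indep :: "'e set set"

locale matroid =
  fixes M :: "'e matroid_data"
  assumes finite_ground: "finite (ground M)"
    and indep_subset: "X \<in> indep M \<Longrightarrow> X \<subseteq> ground M"
    and empty_indep: "{} \<in> indep M"
    and indep_mono: "X \<in> indep M \<Longrightarrow> Y \<subseteq> X \<Longrightarrow> Y \<in> indep M"
    and augment: "X \<in> indep M \<Longrightarrow> Y \<in> indep M \<Longrightarrow> card X < card Y \<Longrightarrow>
      \<exists>y \<in> Y - X. insert y X \<in> indep M"

definition matroid_circuit :: "'e matroid_data \<Rightarrow> 'e set \<Rightarrow> bool" where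
  "matroid_circuit M C \<longleftrightarrow>
    C \<subseteq> ground M \<and> C \<notin> indep M \<and> (\<forall>D. D \<subset> C \<longrightarrow> D \<in> indep M)"

definition matroid_loop :: "'e matroid_data \<Rightarrow> 'e \<Rightarrow> bool" where
  "matroid_loop M e \<longleftrightarrow> matroid_circuit M {e}"

definition matroid_parallel :: "'e matroid_data \<Rightarrow> 'e \<Rightarrow> 'e \<Rightarrow> bool" where
  "matroid_parallel M e f \<longleftrightarrow> e \<noteq> f \<and> matroid_circuit M {e, f}"

definition matroid_connected :: "'e matroid_data \<Rightarrow> bool" where
  "matroid_connected M \<longleftrightarrow>
    (\<forall>e \<in> ground M. \<forall>f \<in> ground M. e \<noteq> f \<longrightarrow>
      (\<exists>C. matroid_circuit M C \<and> e \<in> C \<and> f \<in> C))"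

text \<open>
  The components of a matroid are the classes of the relation that identifies an element with
  itself and with the elements with which it shares a circuit. They are represented by their
  ground sets.
\<close>

definition same_component :: "'e matroid_data \<Rightarrow> 'e rel" where
  "same_component M = {(e, f). e \<in> ground M \<and> f \<in> ground M \<and>
    (e = f \<or> (\<exists>C. matroid_circuit M C \<and> e \<in> C \<and> f \<in> C))}"

definition matroid_components :: "'e matroid_data \<Rightarrow> 'e set set" where
  "matroid_components M = ground M // same_component M"

text \<open>The direct sum presupposes that the ground sets of the summands are pairwise disjoint.\<close>

definition direct_sum :: "'i set \<Rightarrow> ('i \<Rightarrow> 'e matroid_data) \<Rightarrow> 'e matroid_data" where
  "direct_sum I M =
    \<lparr> ground = (\<Union>i\<in>I. ground (M i)),
      indep = {\<Union>i\<in>I. X i | X. \<forall>i\<in>I. X i \<in> indep (M i)} \<rparr>"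


section \<open>Matroids represented by the columns of a matrix\<close>

text \<open>
  A matrix with row set \<open>R\<close> and column set \<open>E\<close> is a function \<open>A\<close>, with \<open>A r e\<close> the
  entry in row \<open>r\<close> and column \<open>e\<close>. Independence is that of the family of columns
  indexed by \<open>S\<close>, so two equal columns are dependent.
\<close>

definition columns_independent :: "'r set \<Rightarrow> ('r \<Rightarrow> 'e \<Rightarrow> 'k::field) \<Rightarrow> 'e set \<Rightarrow> bool" where
  "columns_independent R A S \<longleftrightarrow>
    (\<forall>c. (\<forall>r\<in>R. (\<Sum>e\<in>S. c e * A r e) = 0) \<longrightarrow> (\<forall>e\<in>S. c e = 0))"

definition column_matroid :: "'r set \<Rightarrow> 'e set \<Rightarrow> ('r \<Rightarrow> 'e \<Rightarrow> 'k::field) \<Rightarrow> 'e matroid_data" where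
  "column_matroid R E A = \<lparr> ground = E, indep = {S. S \<subseteq> E \<and> columns_independent R A S} \<rparr>"

definition fun_scale :: "'k::field \<Rightarrow> ('r \<Rightarrow> 'k) \<Rightarrow> 'r \<Rightarrow> 'k" where
  "fun_scale c f = (\<lambda>r. c * f r)"

interpretation fun_space: vector_space fun_scale
  by standard (auto simp: fun_scale_def algebra_simps fun_eq_iff)

definition column :: "'r set \<Rightarrow> ('r \<Rightarrow> 'e \<Rightarrow> 'k::field) \<Rightarrow> 'e \<Rightarrow> 'r \<Rightarrow> 'k" where
  "column R A e = (\<lambda>r. if r \<in> R then A r e else 0)"

lemma sum_fun_apply: "(\<Sum>x\<in>S. f x) r = (\<Sum>x\<in>S. f x r)"
  by (induction S rule: infinite_finite_induct) auto

lemma sum_column_eq_0_iff: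
  "(\<Sum>e\<in>S. fun_scale (c e) (column R A e)) = 0 \<longleftrightarrow> (\<forall>r\<in>R. (\<Sum>e\<in>S. c e * A r e) = 0)"
proof -
  have "(\<Sum>e\<in>S. fun_scale (c e) (column R A e)) r =
      (if r \<in> R then \<Sum>e\<in>S. c e * A r e else 0)" for r
    by (auto simp: sum_fun_apply fun_scale_def column_def)
  then show ?thesis by (auto simp: fun_eq_iff)
qed

lemma columns_independent_iff:
  fixes A :: "'r \<Rightarrow> 'e \<Rightarrow> 'k::field"
  assumes "finite S"
  shows "columns_independent R A S \<longleftrightarrow>
    inj_on (column R A) S \<and> fun_space.independent (column R A ` S)"
    (is "?L \<longleftrightarrow> ?R")
proof
  assume L: ?L
  have zero: "\<forall>e\<in>S. c e = 0"
    if "(\<Sum>e\<in>S. fun_scale (c e) (column R A e)) = 0" for c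
    using L that unfolding columns_independent_def sum_column_eq_0_iff by blast
  have inj: "inj_on (column R A) S"
  proof (rule inj_onI, rule ccontr)
    fix x y assume xy: "x \<in> S" "y \<in> S" "column R A x = column R A y" "x \<noteq> y"
    define c :: "'e \<Rightarrow> 'k" where "c = (\<lambda>e. if e = x then 1 else if e = y then - 1 else 0)"
    have "(\<Sum>e\<in>S. fun_scale (c e) (column R A e)) =
        (\<Sum>e\<in>{x, y}. fun_scale (c e) (column R A e))"
      using assms xy by (intro sum.mono_neutral_right) (auto simp: c_def fun_scale_def fun_eq_iff)
    also have "\<dots> = 0" using xy by (auto simp: c_def fun_scale_def fun_eq_iff)
    finally have "c x = 0" using zero xy by blast
    then show False by (simp add: c_def)
  qed
  have "fun_space.independent (column R A ` S)"
  proof (rule fun_space.independent_if_scalars_zero)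
    fix f v assume f: "(\<Sum>v\<in>column R A ` S. fun_scale (f v) v) = 0" and "v \<in> column R A ` S"
    then show "f v = 0"
      using zero[of "f \<circ> column R A"] by (auto simp: sum.reindex[OF inj])
  qed (use assms in auto)
  with inj show ?R by blast
next
  assume R: ?R
  show ?L unfolding columns_independent_def sum_column_eq_0_iff[symmetric]
  proof (intro allI impI ballI)
    fix c e assume c: "(\<Sum>e\<in>S. fun_scale (c e) (column R A e)) = 0" and e: "e \<in> S"
    let ?u = "c \<circ> the_inv_into S (column R A)"
    have "(\<Sum>v\<in>column R A ` S. fun_scale (?u v) v) = (\<Sum>e\<in>S. fun_scale (c e) (column R A e))"
      using R by (subst sum.reindex) (auto simp: the_inv_into_f_f intro!: sum.cong)
    then have "?u (column R A e) = 0"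
      using R assms e c
      by (intro fun_space.independentD[of "column R A ` S" "column R A ` S" ?u]) auto
    then show "c e = 0" using R e by (simp add: the_inv_into_f_f)
  qed
qed

lemma column_matroid_simps [simp]:
  "ground (column_matroid R E A) = E"
  "X \<in> indep (column_matroid R E A) \<longleftrightarrow> X \<subseteq> E \<and> columns_independent R A X"
  by (simp_all add: column_matroid_def)

lemma matroid_column_matroid:
  assumes "finite E"
  shows "matroid (column_matroid R E (A :: 'r \<Rightarrow> 'e \<Rightarrow> 'k::field))"
proof (rule matroid.intro; (unfold column_matroid_simps)?)
  fix X Y assume X: "X \<subseteq> E \<and> columns_independent R A X" and YX: "Y \<subseteq> X"
  have fX: "finite X" and fY: "finite Y" using assms X YX by (metis finite_subset)+
  show "Y \<subseteq> E \<and> columns_independent R A Y"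
    using X YX unfolding columns_independent_iff[OF fX] columns_independent_iff[OF fY]
    by (metis image_mono fun_space.independent_mono inj_on_subset order_trans)
next
  fix X Y assume X: "X \<subseteq> E \<and> columns_independent R A X"
    and Y: "Y \<subseteq> E \<and> columns_independent R A Y" and card: "card X < card Y"
  have fX: "finite X" and fY: "finite Y" using assms X Y by (metis finite_subset)+
  let ?f = "column R A"
  from X Y have iX: "inj_on ?f X" "fun_space.independent (?f ` X)"
    and iY: "inj_on ?f Y" "fun_space.independent (?f ` Y)"
    using columns_independent_iff fX fY by blast+
  have "\<not> ?f ` Y \<subseteq> fun_space.span (?f ` X)"
    using fun_space.independent_span_bound[of "?f ` X" "?f ` Y"] iX iY card fX
    by (auto simp: card_image)
  then obtain y where y: "y \<in> Y" "?f y \<notin> fun_space.span (?f ` X)" by blast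
  then have nin: "?f y \<notin> ?f ` X" using fun_space.span_base by blast
  then have "y \<notin> X" by blast
  have "columns_independent R A (insert y X)"
    using iX y nin fX \<open>y \<notin> X\<close>
    by (subst columns_independent_iff) (auto simp: fun_space.independent_insert)
  with y \<open>y \<notin> X\<close> X Y
  show "\<exists>y\<in>Y - X. insert y X \<subseteq> E \<and> columns_independent R A (insert y X)" by blast
qed (use assms in \<open>auto simp: columns_independent_def\<close>)


section \<open>Looped simple graphs and their isotropic matroids\<close>

text \<open>
  As in the underlying library, undirected graphs are symmetric digraphs: a non-loop edge is
  a pair of opposite arcs, and a loop is a single arc.
\<close>

locale looped_simple_graph = pseudo_graph + nomulti_digraph

definition graph_components :: "('a, 'b) pre_digraph \<Rightarrow> ('a, 'b) pre_digraph set" where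
  "graph_components G = {H. pre_digraph.max_subgraph G connected H}"

lemma strongly_connected_imp_connected:
  assumes "wf_digraph G" "strongly_connected G"
  shows "connected G"
  using assms wf_digraph.reachable_mk_symmetricI[OF assms(1)]
  unfolding connected_def strongly_connected_def by auto

lemma arc_mono_connected: "arc_mono connected"
  unfolding arc_mono_def
proof (intro allI impI; elim conjE)
  fix H1 H2 :: "('a, 'b) pre_digraph"
  assume H: "connected H1" "subgraph H1 H2" "verts H1 = verts H2"
  then have "wf_digraph H2" by auto
  moreover have "spanning H1 H2" using H by (simp add: spanning_def)
  ultimately show "connected H2"
    using H wf_digraph.connected_spanning_imp_connected by blast
qed

lemma (in sym_digraph) graph_components_eq_sccs: "graph_components G = sccs"
proof (intro set_eqI iffI)
  fix H
  assume "H \<in> graph_components G"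
  then have H: "max_subgraph connected H" by (simp add: graph_components_def)
  then have ind: "induced_subgraph H G" using arc_mono_connected by (rule induced_subgraphI_arc_mono)
  then have "symmetric H" using sym_arcs induced_graph_imp_symmetric by blast
  then have "strongly_connected H"
    using ind max_subgraph_prop[OF H] wf_digraph.symmetric_connected_imp_strongly_connected
    by blast
  then have "max_subgraph strongly_connected H"
    using H unfolding max_subgraph_def
    by (metis strongly_connected_imp_connected subgraphE)
  then show "H \<in> sccs" by (simp add: sccs_altdef2)
next
  fix H
  assume "H \<in> sccs"
  then have H: "max_subgraph strongly_connected H" by (simp add: sccs_altdef2)
  then have sub: "subgraph H G" and sc: "strongly_connected H"
    by (auto simp: max_subgraph_def)
  have "max_subgraph connected H"
  proof (rule max_subgraphI)
    show "connected H" using sc sub strongly_connected_imp_connected by blast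
    fix K assume K: "H \<noteq> K" "subgraph H K" "subgraph K G"
    show "\<not> connected K"
    proof
      assume "connected K"
      let ?K = "G \<restriction> verts K"
      have KK: "subgraph K ?K" using K subgraph_induce_subgraphI2 by blast
      have ind: "induced_subgraph ?K G"
        using K by (intro induced_induce) auto
      have "connected ?K"
        using arc_mono_connected KK \<open>connected K\<close> unfolding arc_mono_def by (metis induce_subgraph_verts)
      moreover have "symmetric ?K" using sym_arcs ind induced_graph_imp_symmetric by blast
      ultimately have "strongly_connected ?K"
        using ind wf_digraph.symmetric_connected_imp_strongly_connected by blast
      moreover have "subgraph H ?K" using K KK subgraph_trans by blast
      moreover have "subgraph ?K G" using ind by blast
      ultimately have "H = ?K" using H unfolding max_subgraph_def by metis
      then have "verts H = verts K" "arcs H = arcs K" "tail H = tail K" "head H = head K"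
        using K KK by (auto simp: subgraph_def compatible_def)
      then show False using K by simp
    qed
  qed (rule sub)
  then show "H \<in> graph_components G" by (simp add: graph_components_def)
qed

definition identity_matrix :: "'a \<Rightarrow> 'a \<Rightarrow> bit" where
  "identity_matrix u v = of_bool (u = v)"

definition adjacency_matrix :: "('a, 'b) pre_digraph \<Rightarrow> 'a \<Rightarrow> 'a \<Rightarrow> bit" where
  "adjacency_matrix G u v = of_bool (u \<rightarrow>\<^bsub>G\<^esub> v)"

datatype column_kind = Phi | Chi | Psi

fun IAS_matrix :: "('a, 'b) pre_digraph \<Rightarrow> 'a \<Rightarrow> 'a \<times> column_kind \<Rightarrow> bit" where
  "IAS_matrix G u (v, Phi) = identity_matrix u v"
| "IAS_matrix G u (v, Chi) = adjacency_matrix G u v"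
| "IAS_matrix G u (v, Psi) = identity_matrix u v + adjacency_matrix G u v"

definition IAS_ground :: "('a, 'b) pre_digraph \<Rightarrow> ('a \<times> column_kind) set" where
  "IAS_ground G = verts G \<times> UNIV"

definition IAS_matroid :: "('a, 'b) pre_digraph \<Rightarrow> ('a \<times> column_kind) matroid_data" where
  "IAS_matroid G = column_matroid (verts G) (IAS_ground G) (IAS_matrix G)"

lemma finite_UNIV_column_kind: "finite (UNIV :: column_kind set)"
proof -
  have "(UNIV :: column_kind set) = {Phi, Chi, Psi}" using column_kind.exhaust by blast
  then show ?thesis by (metis finite.emptyI finite.insertI)
qed

lemma matroid_IAS_matroid: "finite (verts G) \<Longrightarrow> matroid (IAS_matroid G)"
  unfolding IAS_matroid_def IAS_ground_def
  by (intro matroid_column_matroid finite_cartesian_product finite_UNIV_column_kind)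

end

(*
  The rows and columns of (I | A | I + A) split into blocks along the components of the graph, which
  gives the direct sum. Over GF(2) circuits are the minimal nonempty sets of columns with sum zero,
  and sharing a circuit is transitive. If a vertex v has a neighbour other than itself, its three
  columns form a circuit, and the column v_chi together with the columns u_phi of all neighbours u
  of v is always a circuit; these circuits link all columns of a connected graph with at least two
  vertices.
*)
theory Submission
  imports Defs
begin

section \<open>Direct sums of column matroids\<close>

text \<open>A row of block \<open>i\<close> vanishes on all columns of \<open>S\<close> outside
  \<open>E i\<close>, so the linear system for the coefficients splits into one system per
  block.\<close>

lemma columns_independent_block_iff:
  fixes A :: "'r \<Rightarrow> 'e \<Rightarrow> 'k::field"
  assumes fin: "finite S" and sub: "S \<subseteq> (\<Union>i\<in>I. E i)"
    and block: "\<And>i j r e. i \<in> I \<Longrightarrow> j \<in> I \<Longrightarrow> i \<noteq> j \<Longrightarrow> r \<in> R i \<Longrightarrow> e \<in> E j \<Longrightarrow> A r e = 0"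
  shows "columns_independent (\<Union>i\<in>I. R i) A S \<longleftrightarrow>
    (\<forall>i\<in>I. columns_independent (R i) A (S \<inter> E i))" (is "?L \<longleftrightarrow> ?R")
proof -
  have part: "(\<Sum>e\<in>S. c e * A r e) = (\<Sum>e\<in>S \<inter> E i. c e * A r e)"
    if "i \<in> I" "r \<in> R i" for i r and c :: "'e \<Rightarrow> 'k"
  proof (intro sum.mono_neutral_right ballI)
    fix e assume e: "e \<in> S - S \<inter> E i"
    then obtain j where j: "j \<in> I" "e \<in> E j" using sub by blast
    then have "A r e = 0" using e that block[of i j r e] by blast
    then show "c e * A r e = 0" by simp
  qed (use fin in auto)
  show ?thesis
  proof
    assume L: ?L
    show ?R unfolding columns_independent_def
    proof (intro ballI allI impI)
      fix i c e
      assume i: "i \<in> I" and c: "\<forall>r\<in>R i. (\<Sum>e\<in>S \<inter> E i. c e * A r e) = 0" and e: "e \<in> S \<inter> E i"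
      \<comment> \<open>Extension by zero turns a dependence within block \<open>i\<close> into one
        of all of \<open>S\<close>: in a row of another block every product vanishes, either by
        \<open>d\<close> or by the entry of \<open>A\<close>.\<close>
      define d where "d = (\<lambda>x. if x \<in> E i then c x else 0)"
      have "(\<Sum>e\<in>S. d e * A r e) = 0" if "j \<in> I" "r \<in> R j" for j r
      proof (cases "j = i")
        case True
        have "(\<Sum>e\<in>S. d e * A r e) = (\<Sum>e\<in>S \<inter> E i. d e * A r e)"
          using part True that by blast
        also have "\<dots> = (\<Sum>e\<in>S \<inter> E i. c e * A r e)" by (simp add: d_def)
        finally show ?thesis using c True that by simp
      next
        case False
        then show ?thesis
          using block[of j i r] i that by (intro sum.neutral) (auto simp: d_def)
      qed
      then have "\<forall>e\<in>S. d e = 0" using L by (auto simp: columns_independent_def)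
      then show "c e = 0" using e by (auto simp: d_def)
    qed
  next
    assume R: ?R
    show ?L unfolding columns_independent_def
    proof (intro allI impI ballI)
      fix c e assume c: "\<forall>r\<in>\<Union>i\<in>I. R i. (\<Sum>e\<in>S. c e * A r e) = 0" and e: "e \<in> S"
      from e sub obtain i where i: "i \<in> I" "e \<in> E i" by blast
      have "\<forall>r\<in>R i. (\<Sum>e\<in>S \<inter> E i. c e * A r e) = 0"
        using c i part by (metis UN_I)
      then show "c e = 0" using R i e by (auto simp: columns_independent_def)
    qed
  qed
qed

text \<open>Disjointness of the \<open>E i\<close> makes a family \<open>X\<close> recoverable from
  its union \<open>S\<close> as \<open>X i = S \<inter> E i\<close>, so the blockwise criterion is
  exactly independence in the direct sum.\<close>

lemma column_matroid_direct_sum: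
  fixes A :: "'r \<Rightarrow> 'e \<Rightarrow> 'k::field"
  assumes fin: "finite (\<Union>i\<in>I. E i)" and disj: "disjoint_family_on E I"
    and block: "\<And>i j r e. i \<in> I \<Longrightarrow> j \<in> I \<Longrightarrow> i \<noteq> j \<Longrightarrow> r \<in> R i \<Longrightarrow> e \<in> E j \<Longrightarrow> A r e = 0"
  shows "column_matroid (\<Union>i\<in>I. R i) (\<Union>i\<in>I. E i) A =
    direct_sum I (\<lambda>i. column_matroid (R i) (E i) A)"
proof -
  have iff: "columns_independent (\<Union>i\<in>I. R i) A S \<longleftrightarrow>
      (\<forall>i\<in>I. columns_independent (R i) A (S \<inter> E i))" if "S \<subseteq> (\<Union>i\<in>I. E i)" for S
    using columns_independent_block_iff[OF finite_subset[OF that fin] that block] .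
  have "S \<subseteq> (\<Union>i\<in>I. E i) \<and> columns_independent (\<Union>i\<in>I. R i) A S \<longleftrightarrow>
      (\<exists>X. S = (\<Union>i\<in>I. X i) \<and> (\<forall>i\<in>I. X i \<subseteq> E i \<and> columns_independent (R i) A (X i)))" for S
  proof
    assume "S \<subseteq> (\<Union>i\<in>I. E i) \<and> columns_independent (\<Union>i\<in>I. R i) A S"
    then show "\<exists>X. S = (\<Union>i\<in>I. X i) \<and> (\<forall>i\<in>I. X i \<subseteq> E i \<and> columns_independent (R i) A (X i))"
      using iff by (intro exI[of _ "\<lambda>i. S \<inter> E i"]) blast
  next
    assume "\<exists>X. S = (\<Union>i\<in>I. X i) \<and> (\<forall>i\<in>I. X i \<subseteq> E i \<and> columns_independent (R i) A (X i))"
    then obtain X where S: "S = (\<Union>i\<in>I. X i)"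
      and X: "\<And>i. i \<in> I \<Longrightarrow> X i \<subseteq> E i \<and> columns_independent (R i) A (X i)" by blast
    have sub: "S \<subseteq> (\<Union>i\<in>I. E i)" using S X by blast
    have "S \<inter> E i = X i" if "i \<in> I" for i
    proof
      show "S \<inter> E i \<subseteq> X i"
      proof
        fix e assume e: "e \<in> S \<inter> E i"
        then obtain j where j: "j \<in> I" "e \<in> X j" using S by blast
        then have "e \<in> E j" using X by blast
        then have "j = i" using e j that disj by (auto simp: disjoint_family_on_def)
        then show "e \<in> X i" using j by simp
      qed
      show "X i \<subseteq> S \<inter> E i" using S X that by blast
    qed
    then show "S \<subseteq> (\<Union>i\<in>I. E i) \<and> columns_independent (\<Union>i\<in>I. R i) A S"
      using sub iff X by simp
  qed
  then show ?thesis by (auto simp: column_matroid_def direct_sum_def)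
qed

text \<open>Allows the matrices of the single components to be replaced by the one matrix of the
  whole graph.\<close>

lemma column_matroid_cong:
  assumes "\<And>r e. r \<in> R \<Longrightarrow> e \<in> E \<Longrightarrow> A r e = B r e"
  shows "column_matroid R E A = column_matroid R E B"
proof -
  have "columns_independent R A S = columns_independent R B S" if "S \<subseteq> E" for S
  proof -
    have "(\<Sum>e\<in>S. c e * A r e) = (\<Sum>e\<in>S. c e * B r e)" if "r \<in> R" for r c
      using assms that \<open>S \<subseteq> E\<close> by (intro sum.cong) auto
    then show ?thesis by (simp add: columns_independent_def)
  qed
  then show ?thesis by (auto simp: column_matroid_def)
qed


section \<open>Circuits of binary matroids\<close>

text \<open>As indicator vectors, the finite sets \<open>T\<close> of this kind form the kernel of
  the matrix over GF(2), the cycle space. An infinite \<open>T\<close> has sum 0 by default, hence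
  the finiteness hypotheses below.\<close>

definition zero_sum :: "'r set \<Rightarrow> ('r \<Rightarrow> 'e \<Rightarrow> bit) \<Rightarrow> 'e set \<Rightarrow> bool" where
  "zero_sum R A T \<longleftrightarrow> (\<forall>r\<in>R. (\<Sum>e\<in>T. A r e) = 0)"

text \<open>Over GF(2) a coefficient function on \<open>S\<close> is the indicator of the set where
  it is 1, so nontrivial dependences are nonempty zero-sum subsets.\<close>

lemma columns_independent_bit_iff:
  assumes "finite S"
  shows "columns_independent R A S \<longleftrightarrow> (\<forall>T\<subseteq>S. zero_sum R A T \<longrightarrow> T = {})" (is "?L \<longleftrightarrow> ?R")
proof
  assume L: ?L
  show ?R
  proof (intro allI impI)
    fix T assume T: "T \<subseteq> S" "zero_sum R A T"
    have "(\<Sum>e\<in>S. of_bool (e \<in> T) * A r e) = (\<Sum>e\<in>T. A r e)" for r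
      using assms T by (intro sum.mono_neutral_cong_right) auto
    then have "\<forall>r\<in>R. (\<Sum>e\<in>S. of_bool (e \<in> T) * A r e) = 0"
      using T by (simp add: zero_sum_def)
    then have "\<forall>e\<in>S. of_bool (e \<in> T) = (0 :: bit)"
      using L by (auto simp only: columns_independent_def)
    then show "T = {}" using T by auto
  qed
next
  assume R: ?R
  show ?L unfolding columns_independent_def
  proof (intro allI impI ballI)
    fix c e assume c: "\<forall>r\<in>R. (\<Sum>e\<in>S. c e * A r e) = 0" and e: "e \<in> S"
    have "(\<Sum>e\<in>S. c e * A r e) = (\<Sum>e\<in>{e \<in> S. c e = 1}. A r e)" for r
      using assms by (intro sum.mono_neutral_cong_right) auto
    then have "zero_sum R A {e \<in> S. c e = 1}" using c by (simp add: zero_sum_def)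
    then have "{e \<in> S. c e = 1} = {}" using R[rule_format, of "{e \<in> S. c e = 1}"] by simp
    then show "c e = 0" using e by auto
  qed
qed

lemma matroid_circuit_bit_iff:
  assumes "finite E"
  shows "matroid_circuit (column_matroid R E A) C \<longleftrightarrow>
    C \<subseteq> E \<and> C \<noteq> {} \<and> zero_sum R A C \<and> (\<forall>T\<subseteq>C. zero_sum R A T \<longrightarrow> T = {} \<or> T = C)"
proof (cases "C \<subseteq> E")
  case True
  have *: "columns_independent R A S \<longleftrightarrow> (\<forall>T\<subseteq>S. zero_sum R A T \<longrightarrow> T = {})" if "S \<subseteq> E" for S
    using columns_independent_bit_iff that assms finite_subset by metis
  have "matroid_circuit (column_matroid R E A) C \<longleftrightarrow>
      \<not> columns_independent R A C \<and> (\<forall>D. D \<subset> C \<longrightarrow> columns_independent R A D)"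
    using True by (auto simp: matroid_circuit_def)
  also have "\<dots> \<longleftrightarrow> (\<exists>T\<subseteq>C. zero_sum R A T \<and> T \<noteq> {}) \<and>
      (\<forall>D. D \<subset> C \<longrightarrow> (\<forall>T\<subseteq>D. zero_sum R A T \<longrightarrow> T = {}))"
    using *[OF True] *[OF order_trans[OF psubset_imp_subset True]] by simp
  also have "\<dots> \<longleftrightarrow> C \<noteq> {} \<and> zero_sum R A C \<and> (\<forall>T\<subseteq>C. zero_sum R A T \<longrightarrow> T = {} \<or> T = C)"
    by blast
  finally show ?thesis using True by blast
qed (auto simp: matroid_circuit_def)

text \<open>Symmetric difference is addition of indicator vectors: the columns in
  \<open>S \<inter> T\<close> are counted twice and cancel.\<close>

lemma zero_sum_sym_diff:
  assumes "zero_sum R A S" "zero_sum R A T" "finite S" "finite T"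
  shows "zero_sum R A (sym_diff S T)"
  unfolding zero_sum_def
proof
  fix r assume r: "r \<in> R"
  have S: "(\<Sum>e\<in>S. A r e) = (\<Sum>e\<in>S - T. A r e) + (\<Sum>e\<in>S \<inter> T. A r e)"
    using assms by (metis add.commute sum.Int_Diff)
  have T: "(\<Sum>e\<in>T. A r e) = (\<Sum>e\<in>T - S. A r e) + (\<Sum>e\<in>S \<inter> T. A r e)"
    using assms by (metis Int_commute add.commute sum.Int_Diff)
  have bit: "a + c = 0 \<Longrightarrow> b + c = 0 \<Longrightarrow> a + b = 0" for a b c :: bit
    by (cases a; cases b; cases c) auto
  have "(\<Sum>e\<in>sym_diff S T. A r e) = (\<Sum>e\<in>S - T. A r e) + (\<Sum>e\<in>T - S. A r e)"
    using assms by (intro sum.union_disjoint) auto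
  also have "\<dots> = 0"
  proof (rule bit)
    show "(\<Sum>e\<in>S - T. A r e) + (\<Sum>e\<in>S \<inter> T. A r e) = 0"
      unfolding S[symmetric] using assms(1) r by (simp add: zero_sum_def)
    show "(\<Sum>e\<in>T - S. A r e) + (\<Sum>e\<in>S \<inter> T. A r e) = 0"
      unfolding T[symmetric] using assms(2) r by (simp add: zero_sum_def)
  qed
  finally show "(\<Sum>e\<in>sym_diff S T. A r e) = 0" .
qed

text \<open>A nonempty zero-sum set that is no circuit splits into two smaller zero-sum sets
  \<open>D\<close> and \<open>T - D\<close>; the induction continues in the one that contains
  \<open>e\<close>.\<close>

lemma zero_sum_obtain_circuit:
  assumes "finite E" "T \<subseteq> E" "zero_sum R A T" "e \<in> T"
  obtains C where "matroid_circuit (column_matroid R E A) C" "e \<in> C" "C \<subseteq> T"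
proof -
  have "finite T" using assms finite_subset by blast
  then have "\<exists>C. matroid_circuit (column_matroid R E A) C \<and> e \<in> C \<and> C \<subseteq> T" using assms
  proof (induction T rule: finite_psubset_induct)
    case (psubset T)
    show ?case
    proof (cases "matroid_circuit (column_matroid R E A) T")
      case False
      then obtain D where D: "D \<subset> T" "zero_sum R A D" "D \<noteq> {}"
        using psubset.prems by (auto simp: matroid_circuit_bit_iff)
      then have "sym_diff T D = T - D" by blast
      moreover have "zero_sum R A (sym_diff T D)"
        using D psubset.hyps psubset.prems by (intro zero_sum_sym_diff) (auto intro: finite_subset)
      ultimately have "zero_sum R A (T - D)" by simp
      moreover have "T - D \<subset> T" using D by blast
      moreover have "e \<in> D \<or> e \<in> T - D" using psubset.prems by blast
      ultimately obtain T' where "T' \<subset> T" "zero_sum R A T'" "e \<in> T'" using D by blast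
      then show ?thesis using psubset.IH[of T'] psubset.prems by blast
    qed (use psubset.prems in blast)
  qed
  then show ?thesis using that by blast
qed

text \<open>
  Suppose no circuit contains both \<open>e\<close> and \<open>g\<close>, and take intersecting circuits \<open>C\<close> through
  \<open>e\<close> and \<open>D\<close> through \<open>g\<close> with \<open>C \<union> D\<close> as small as possible. Their symmetric difference
  contains disjoint circuits \<open>X\<close> through \<open>e\<close> and \<open>Y\<close> through \<open>g\<close>. Now \<open>X\<close> meets \<open>D - C\<close>,
  while minimality, applied to \<open>C\<close> and \<open>Y\<close>, gives \<open>D - C \<subseteq> Y\<close>.
\<close>

lemma binary_circuits_trans:
  fixes A :: "'r \<Rightarrow> 'e \<Rightarrow> bit"
  assumes E: "finite E"
    and C1: "matroid_circuit (column_matroid R E A) C1" "e \<in> C1"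
    and C2: "matroid_circuit (column_matroid R E A) C2" "g \<in> C2"
    and meet: "C1 \<inter> C2 \<noteq> {}"
  shows "\<exists>C. matroid_circuit (column_matroid R E A) C \<and> e \<in> C \<and> g \<in> C"
proof (rule ccontr)
  let ?circ = "matroid_circuit (column_matroid R E A)"
  assume none: "\<nexists>C. ?circ C \<and> e \<in> C \<and> g \<in> C"
  let ?P = "\<lambda>(C, D). ?circ C \<and> e \<in> C \<and> ?circ D \<and> g \<in> D \<and> C \<inter> D \<noteq> {}"
  have "\<exists>p. ?P p \<and> (\<forall>q. ?P q \<longrightarrow> card (fst p \<union> snd p) \<le> card (fst q \<union> snd q))"
    using C1 C2 meet by (intro ex_has_least_nat[of ?P "(C1, C2)"]) simp
  then obtain p where p: "?P p" "\<forall>q. ?P q \<longrightarrow> card (fst p \<union> snd p) \<le> card (fst q \<union> snd q)"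
    by blast
  obtain C D where "p = (C, D)" by (rule prod.exhaust)
  with p have C: "?circ C" "e \<in> C" and D: "?circ D" "g \<in> D" and CD: "C \<inter> D \<noteq> {}"
    and min: "\<And>C' D'. ?circ C' \<Longrightarrow> e \<in> C' \<Longrightarrow> ?circ D' \<Longrightarrow> g \<in> D' \<Longrightarrow> C' \<inter> D' \<noteq> {} \<Longrightarrow>
      card (C \<union> D) \<le> card (C' \<union> D')"
    by auto
  have circD: "K \<subseteq> E" "finite K" "zero_sum R A K" if "?circ K" for K
    using that E finite_subset by (auto simp: matroid_circuit_bit_iff)
  have proper: "K = K'" if "?circ K" "?circ K'" "K \<subseteq> K'" for K K'
    using that unfolding matroid_circuit_bit_iff[OF E] by blast
  have covers: "C' \<union> D' = C \<union> D"
    if "?circ C'" "e \<in> C'" "?circ D'" "g \<in> D'" "C' \<inter> D' \<noteq> {}" "C' \<union> D' \<subseteq> C \<union> D" for C' D'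
    using that min[OF that(1-5)] circD(2)[OF C(1)] circD(2)[OF D(1)] by (intro card_seteq) auto
  let ?S = "sym_diff C D"
  have S: "zero_sum R A ?S" "?S \<subseteq> E"
    using zero_sum_sym_diff[of R A C D] circD[OF C(1)] circD[OF D(1)] by blast+
  \<comment> \<open>Were \<open>e\<close> in \<open>D\<close> or \<open>g\<close> in
    \<open>C\<close>, a single circuit would contain both.\<close>
  have e: "e \<in> ?S" and g: "g \<in> ?S" using none C D by auto
  obtain X where X: "?circ X" "e \<in> X" "X \<subseteq> ?S"
    using zero_sum_obtain_circuit[OF E S(2,1) e] by blast
  have "sym_diff ?S X = ?S - X" using X by blast
  moreover have "zero_sum R A (sym_diff ?S X)"
    by (rule zero_sum_sym_diff[OF S(1) circD(3)[OF X(1)] finite_subset[OF S(2) E] circD(2)[OF X(1)]])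
  ultimately have "zero_sum R A (?S - X)" by simp
  moreover have "g \<in> ?S - X" using g X none by blast
  ultimately obtain Y where Y: "?circ Y" "g \<in> Y" "Y \<subseteq> ?S - X"
    using zero_sum_obtain_circuit[OF E, of "?S - X"] S by blast
  \<comment> \<open>\<open>X\<close> and \<open>Y\<close> miss the nonempty set
    \<open>C \<inter> D\<close>, so they differ from \<open>C\<close> and \<open>D\<close> and,
    being circuits, are not contained in them.\<close>
  have "\<not> X \<subseteq> C" using proper[OF X(1) C(1)] X(3) CD by blast
  then have XD: "X \<inter> (D - C) \<noteq> {}" using X(3) by blast
  have "\<not> Y \<subseteq> D" using proper[OF Y(1) D(1)] Y(3) CD by blast
  then have YC: "C \<inter> Y \<noteq> {}" using Y(3) by blast
  have "C \<union> Y = C \<union> D" using covers[OF C Y(1,2) YC] Y(3) by blast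
  then have "D - C \<subseteq> Y" by blast
  then show False using XD Y(3) by blast
qed

text \<open>The circuits through \<open>e\<close>, \<open>f\<close> and through \<open>f\<close>,
  \<open>g\<close> meet in \<open>f\<close>. Transitivity later allows connectedness to be shown by
  chaining circuits.\<close>

lemma trans_same_component_bit:
  fixes A :: "'r \<Rightarrow> 'e \<Rightarrow> bit"
  assumes "finite E"
  shows "trans (same_component (column_matroid R E A))"
proof (rule transI)
  fix e f g
  assume ef: "(e, f) \<in> same_component (column_matroid R E A)"
    and fg: "(f, g) \<in> same_component (column_matroid R E A)"
  show "(e, g) \<in> same_component (column_matroid R E A)"
  proof (cases "e = f \<or> f = g")
    case False
    then obtain C D where "matroid_circuit (column_matroid R E A) C" "e \<in> C" "f \<in> C"
      "matroid_circuit (column_matroid R E A) D" "f \<in> D" "g \<in> D"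
      using ef fg by (auto simp: same_component_def)
    then have "\<exists>C. matroid_circuit (column_matroid R E A) C \<and> e \<in> C \<and> g \<in> C"
      using binary_circuits_trans[OF assms, of R A C e D g] by blast
    then show ?thesis using ef fg by (auto simp: same_component_def)
  qed (use ef fg in auto)
qed


section \<open>Isotropic matroids\<close>

lemma finite_IAS_ground: "finite (verts G) \<Longrightarrow> finite (IAS_ground G)"
  by (simp add: IAS_ground_def finite_UNIV_column_kind)

lemma UNIV_column_kind: "(UNIV :: column_kind set) = {Phi, Chi, Psi}"
  using column_kind.exhaust by blast

text \<open>Makes the adjacency matrix of an induced subgraph a submatrix of that of
  \<open>G\<close>.\<close>

lemma dominates_induced_iff:
  assumes "induced_subgraph H G" "u \<in> verts H" "v \<in> verts H"
  shows "u \<rightarrow>\<^bsub>H\<^esub> v \<longleftrightarrow> u \<rightarrow>\<^bsub>G\<^esub> v"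
  using assms by (auto simp: induced_subgraph_def subgraph_def compatible_def arcs_ends_conv image_iff)

text \<open>Distinct components share no vertex and no arc joins them, so the off-diagonal blocks of
  the identity and of the adjacency matrix vanish. In a symmetric digraph the strongly connected
  components are the connected ones.\<close>

lemma IAS_matroid_direct_sum_sccs:
  assumes "pseudo_graph G"
  shows "disjoint_family_on (\<lambda>H. ground (IAS_matroid H)) (pre_digraph.sccs G) \<and>
    IAS_matroid G = direct_sum (pre_digraph.sccs G) IAS_matroid"
proof -
  interpret pseudo_graph G by fact
  have union: "verts G = (\<Union>H\<in>sccs. verts H)" "arcs G = (\<Union>H\<in>sccs. arcs H)"
    using arg_cong[OF graph_is_union_sccs, of verts] arg_cong[OF graph_is_union_sccs, of arcs]
    by (auto simp: Union_def)
  have ground: "(\<Union>H\<in>sccs. IAS_ground H) = IAS_ground G"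
    by (auto simp: IAS_ground_def union(1))
  have disj: "disjoint_family_on IAS_ground sccs"
    using scc_disj by (auto simp: disjoint_family_on_def IAS_ground_def)
  have cross: "\<not> u \<rightarrow>\<^bsub>G\<^esub> v"
    if HK: "H \<in> sccs" "K \<in> sccs" "H \<noteq> K" and uv: "u \<in> verts H" "v \<in> verts K" for H K u v
  proof
    assume "u \<rightarrow>\<^bsub>G\<^esub> v"
    then obtain a where a: "a \<in> arcs G" "tail G a = u" "head G a = v" by blast
    \<comment> \<open>The component \<open>L\<close> that owns the arc contains both its ends, so it
      would have to equal both \<open>H\<close> and \<open>K\<close>.\<close>
    then obtain L where L: "L \<in> sccs" "a \<in> arcs L" using union(2) by blast
    then have "u \<in> verts L" "v \<in> verts L"
      using a by (auto dest!: in_sccs_imp_induced simp: induced_subgraph_def)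
    then show False using scc_disj HK uv L(1) by (metis disjoint_iff)
  qed
  have "direct_sum sccs IAS_matroid =
      direct_sum sccs (\<lambda>H. column_matroid (verts H) (IAS_ground H) (IAS_matrix G))"
  proof -
    have "IAS_matroid H = column_matroid (verts H) (IAS_ground H) (IAS_matrix G)"
      if H: "H \<in> sccs" for H
      unfolding IAS_matroid_def
    proof (rule column_matroid_cong)
      fix r e assume "r \<in> verts H" "e \<in> IAS_ground H"
      then show "IAS_matrix H r e = IAS_matrix G r e"
        using dominates_induced_iff[OF in_sccs_imp_induced[OF H]]
        by (cases "(H, r, e)" rule: IAS_matrix.cases)
          (auto simp: IAS_ground_def adjacency_matrix_def)
    qed
    then show ?thesis by (simp add: direct_sum_def cong: SUP_cong)
  qed
  also have "\<dots> = column_matroid (\<Union>H\<in>sccs. verts H) (\<Union>H\<in>sccs. IAS_ground H) (IAS_matrix G)"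
  proof (rule column_matroid_direct_sum[symmetric])
    show "finite (\<Union>H\<in>sccs. IAS_ground H)"
      unfolding ground by (rule finite_IAS_ground[OF finite_verts])
    fix H K u e assume HK: "H \<in> sccs" "K \<in> sccs" "H \<noteq> K" "u \<in> verts H" "e \<in> IAS_ground K"
    then have "u \<noteq> fst e" "\<not> u \<rightarrow>\<^bsub>G\<^esub> fst e"
      using cross scc_disj[OF HK(1,2)] by (auto simp: IAS_ground_def)
    then show "IAS_matrix G u e = 0"
      by (cases "(G, u, e)" rule: IAS_matrix.cases)
        (auto simp: identity_matrix_def adjacency_matrix_def)
  qed (rule disj)
  also have "\<dots> = IAS_matroid G"
    unfolding IAS_matroid_def ground union(1)[symmetric] ..
  finally show ?thesis using disj by (simp add: IAS_matroid_def)
qed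

section \<open>Triangle and star circuits\<close>

lemma sum_vertex_columns:
  assumes "T \<subseteq> {v} \<times> UNIV"
  shows "(\<Sum>e\<in>T. IAS_matrix H r e) =
    of_bool ((v, Phi) \<in> T) * of_bool (r = v) + of_bool ((v, Chi) \<in> T) * of_bool (r \<rightarrow>\<^bsub>H\<^esub> v) +
    of_bool ((v, Psi) \<in> T) * (of_bool (r = v) + of_bool (r \<rightarrow>\<^bsub>H\<^esub> v))"
proof -
  have "(\<Sum>e\<in>T. IAS_matrix H r e) =
      (\<Sum>e\<in>{(v, Phi), (v, Chi), (v, Psi)} \<inter> T. IAS_matrix H r e)"
    using assms by (intro sum.cong) (auto simp: UNIV_column_kind)
  also have "\<dots> = (\<Sum>e\<in>{(v, Phi), (v, Chi), (v, Psi)}. if e \<in> T then IAS_matrix H r e else 0)"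
    by (intro sum.inter_restrict) simp
  finally show ?thesis
    by (cases "(v, Phi) \<in> T"; cases "(v, Chi) \<in> T"; cases "(v, Psi) \<in> T"; cases "r = v";
        cases "r \<rightarrow>\<^bsub>H\<^esub> v")
      (simp_all add: identity_matrix_def adjacency_matrix_def add.assoc)
qed

text \<open>The third column is the sum of the other two. The rows of \<open>w\<close> and
  \<open>v\<close> show that no proper nonempty subset sums to zero.\<close>

lemma triangle_circuit:
  assumes fin: "finite (verts H)" and v: "v \<in> verts H" and w: "w \<in> verts H" "w \<noteq> v" "w \<rightarrow>\<^bsub>H\<^esub> v"
  shows "matroid_circuit (IAS_matroid H) ({v} \<times> UNIV)"
  unfolding IAS_matroid_def matroid_circuit_bit_iff[OF finite_IAS_ground[OF fin]]
proof (intro conjI allI impI)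
  show "{v} \<times> UNIV \<subseteq> IAS_ground H" using v by (auto simp: IAS_ground_def)
  show "zero_sum (verts H) (IAS_matrix H) ({v} \<times> UNIV)"
    unfolding zero_sum_def sum_vertex_columns[OF order_refl] by simp
  fix T assume T: "T \<subseteq> {v} \<times> UNIV" "zero_sum (verts H) (IAS_matrix H) T"
  \<comment> \<open>Row \<open>w\<close> has the entries 0, 1, 1 in the columns \<open>Phi\<close>,
    \<open>Chi\<close>, \<open>Psi\<close> of \<open>v\<close>.\<close>
  have "(v, Chi) \<in> T \<longleftrightarrow> (v, Psi) \<in> T"
    using T w sum_vertex_columns[OF T(1), of H w] by (auto simp: zero_sum_def)
  \<comment> \<open>In row \<open>v\<close> the columns \<open>Chi\<close> and \<open>Psi\<close>
    together contribute 1, whether or not \<open>v\<close> is looped.\<close>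
  moreover have "(v, Phi) \<in> T \<longleftrightarrow> (v, Psi) \<in> T"
    using T v sum_vertex_columns[OF T(1), of H v] calculation by (auto simp: zero_sum_def)
  ultimately show "T = {} \<or> T = {v} \<times> UNIV" using T(1) by (auto simp: UNIV_column_kind)
qed simp

text \<open>The \<open>Chi\<close> column of \<open>v\<close> is the sum of the unit vectors of its
  neighbours, with \<open>v\<close> among them if it is looped. Unit vectors are independent, so a
  nonempty zero-sum subset contains \<open>(v, Chi)\<close> and then every unit vector of the
  star.\<close>

lemma star_circuit:
  assumes fin: "finite (verts H)" and v: "v \<in> verts H"
  shows "matroid_circuit (IAS_matroid H)
    (insert (v, Chi) ((\<lambda>u. (u, Phi)) ` {u \<in> verts H. u \<rightarrow>\<^bsub>H\<^esub> v}))" (is "matroid_circuit _ ?C")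
  unfolding IAS_matroid_def matroid_circuit_bit_iff[OF finite_IAS_ground[OF fin]]
proof (intro conjI allI impI)
  let ?N = "{u \<in> verts H. u \<rightarrow>\<^bsub>H\<^esub> v}"
  have sum: "(\<Sum>e\<in>T. IAS_matrix H r e) =
      of_bool ((v, Chi) \<in> T \<and> r \<rightarrow>\<^bsub>H\<^esub> v) + of_bool ((r, Phi) \<in> T)"
    if "T \<subseteq> ?C" for r T
  proof -
    have "(\<Sum>e\<in>T. IAS_matrix H r e) = (\<Sum>e\<in>?C \<inter> T. IAS_matrix H r e)"
      using that by (simp add: Int_absorb1)
    also have "\<dots> = (\<Sum>e\<in>?C. if e \<in> T then IAS_matrix H r e else 0)"
      using fin by (intro sum.inter_restrict) simp
    also have "\<dots> = of_bool ((v, Chi) \<in> T \<and> r \<rightarrow>\<^bsub>H\<^esub> v) +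
        (\<Sum>e\<in>(\<lambda>u. (u, Phi)) ` ?N. if e \<in> T then IAS_matrix H r e else 0)"
      using fin by (subst sum.insert) (auto simp: adjacency_matrix_def)
    also have "(\<Sum>e\<in>(\<lambda>u. (u, Phi)) ` ?N. if e \<in> T then IAS_matrix H r e else 0) =
        (\<Sum>u\<in>?N. if u = r then of_bool ((r, Phi) \<in> T) else 0)"
      by (subst sum.reindex) (auto simp: inj_on_def identity_matrix_def intro!: sum.cong sum.neutral)
    \<comment> \<open>For \<open>r\<close> outside \<open>?N\<close> the sum is 0; this agrees,
      since then \<open>(r, Phi)\<close> is not in \<open>?C\<close> and hence not in
      \<open>T\<close>.\<close>
    also have "\<dots> = of_bool ((r, Phi) \<in> T)"
      using fin that by (subst sum.delta) auto
    finally show ?thesis .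
  qed
  show "?C \<subseteq> IAS_ground H" using v by (auto simp: IAS_ground_def)
  show "zero_sum (verts H) (IAS_matrix H) ?C"
    unfolding zero_sum_def sum[OF order_refl] by auto
  fix T assume T: "T \<subseteq> ?C" "zero_sum (verts H) (IAS_matrix H) T"
  have "(r, Phi) \<in> T \<longleftrightarrow> (v, Chi) \<in> T \<and> r \<rightarrow>\<^bsub>H\<^esub> v" if "r \<in> verts H" for r
    using T that sum[OF T(1), of r] by (auto simp: zero_sum_def)
  then show "T = {} \<or> T = ?C" using T(1) by auto
qed simp

section \<open>Connectedness for components with several vertices\<close>

lemma IAS_matroid_connected:
  assumes "pseudo_graph H" and conn: "strongly_connected H" and card: "card (verts H) \<noteq> 1"
  shows "matroid_connected (IAS_matroid H)"
proof -
  interpret pseudo_graph H by fact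
  have fin: "finite (verts H)" by simp
  let ?S = "same_component (IAS_matroid H)"
  have sub: "C \<subseteq> IAS_ground H" if "matroid_circuit (IAS_matroid H) C" for C
    using that by (simp add: matroid_circuit_def IAS_matroid_def)
  have S_I: "(e, f) \<in> ?S" if "matroid_circuit (IAS_matroid H) C" "e \<in> C" "f \<in> C" for e f C
    using that sub[OF that(1)] by (auto simp: same_component_def IAS_matroid_def)
  have trans: "trans ?S"
    unfolding IAS_matroid_def by (rule trans_same_component_bit[OF finite_IAS_ground[OF fin]])
  \<comment> \<open>A walk from \<open>v\<close> to another vertex uses an arc from \<open>v\<close>
    to some vertex other than \<open>v\<close>; symmetry reverses this arc.\<close>
  have neighbour: "\<exists>w \<in> verts H. w \<noteq> v \<and> w \<rightarrow>\<^bsub>H\<^esub> v" if v: "v \<in> verts H" for v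
  proof -
    obtain u where u: "u \<in> verts H" "u \<noteq> v"
      using v card by (cases "verts H = {v}") auto
    then have "v \<rightarrow>\<^sup>*\<^bsub>H\<^esub> u" using conn v by blast
    then show ?thesis using u(2)
    proof (induction rule: reachable_induct)
      case (step x y)
      then show ?case by (cases "x = v") (auto intro: adj_in_verts arcs_ends_symmetric[OF sym_arcs])
    qed simp
  qed
  have triangle: "((v, k), (v, l)) \<in> ?S" if "v \<in> verts H" for v k l
    using neighbour[OF that] S_I[OF triangle_circuit[OF fin that]] by blast
  \<comment> \<open>The star at \<open>v\<close> links \<open>(u, Phi)\<close> to
    \<open>(v, Chi)\<close>, and the triangle at \<open>v\<close> leads on to
    \<open>(v, Phi)\<close>.\<close>
  have adjacent: "((u, Phi), (v, Phi)) \<in> ?S" if "u \<in> verts H" "v \<in> verts H" "u \<rightarrow>\<^bsub>H\<^esub> v" for u v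
  proof -
    have "((u, Phi), (v, Chi)) \<in> ?S" using that by (intro S_I[OF star_circuit[OF fin that(2)]]) auto
    then show ?thesis using triangle[OF that(2)] trans by (meson transD)
  qed
  have Phi: "((u, Phi), (v, Phi)) \<in> ?S" if "u \<rightarrow>\<^sup>*\<^bsub>H\<^esub> v" for u v
    using that
  proof (induction rule: reachable_induct)
    case (step x y)
    have "((x, Phi), (y, Phi)) \<in> ?S"
      by (intro adjacent adj_in_verts[OF step.hyps(2)] step.hyps(2))
    with trans step.IH show ?case by (rule transD)
  qed (rule triangle)
  \<comment> \<open>The chain passes through the triangle at \<open>u\<close>, the
    \<open>Phi\<close> columns along a walk and the triangle at \<open>v\<close>.\<close>
  have "((u, k), (v, l)) \<in> ?S" if "u \<in> verts H" "v \<in> verts H" for u v k l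
  proof -
    have "u \<rightarrow>\<^sup>*\<^bsub>H\<^esub> v" using conn that by blast
    then have "((u, Phi), (v, l)) \<in> ?S" using transD[OF trans Phi triangle[OF that(2)]] by blast
    with trans triangle[OF that(1)] show ?thesis by (rule transD)
  qed
  then have "(e, f) \<in> ?S" if "e \<in> IAS_ground H" "f \<in> IAS_ground H" for e f
    using that by (auto simp: IAS_ground_def)
  then show ?thesis
    by (auto simp: matroid_connected_def same_component_def IAS_matroid_def)
qed

section \<open>Components with a single vertex\<close>

lemma IAS_matroid_singleton:
  assumes H: "verts H = {v}"
  obtains x y z where "x \<noteq> y" "x \<noteq> z" "y \<noteq> z" "ground (IAS_matroid H) = {x, y, z}"
    "\<And>C. matroid_circuit (IAS_matroid H) C \<longleftrightarrow> C = {x} \<or> C = {y, z}"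
proof -
  have fin: "finite (verts H)" by (simp add: H)
  \<comment> \<open>The one-row matrix is 1, 1, 0 if \<open>v\<close> is looped and 1, 0, 1
    otherwise: \<open>x\<close> is the zero column, \<open>y\<close> and \<open>z\<close> are the
    two equal ones.\<close>
  define x where "x = (v, if v \<rightarrow>\<^bsub>H\<^esub> v then Psi else Chi)"
  define y where "y = (v, Phi)"
  define z where "z = (v, if v \<rightarrow>\<^bsub>H\<^esub> v then Chi else Psi)"
  have ne: "x \<noteq> y" "x \<noteq> z" "y \<noteq> z" by (auto simp: x_def y_def z_def)
  have ground: "IAS_ground H = {x, y, z}"
    by (auto simp: IAS_ground_def H UNIV_column_kind x_def y_def z_def)
  have zero: "zero_sum (verts H) (IAS_matrix H) T \<longleftrightarrow> (y \<in> T \<longleftrightarrow> z \<in> T)" if "T \<subseteq> {x, y, z}" for T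
  proof -
    have "T \<subseteq> {v} \<times> UNIV" using that by (auto simp: x_def y_def z_def)
    then show ?thesis
      by (auto simp: zero_sum_def H sum_vertex_columns y_def z_def)
  qed
  have "matroid_circuit (IAS_matroid H) C \<longleftrightarrow> C = {x} \<or> C = {y, z}" for C
  proof -
    have "matroid_circuit (IAS_matroid H) C \<longleftrightarrow> C \<subseteq> {x, y, z} \<and> C \<noteq> {} \<and> (y \<in> C \<longleftrightarrow> z \<in> C) \<and>
        (\<forall>T\<subseteq>C. (y \<in> T \<longleftrightarrow> z \<in> T) \<longrightarrow> T = {} \<or> T = C)"
      unfolding IAS_matroid_def matroid_circuit_bit_iff[OF finite_IAS_ground[OF fin]]
      unfolding ground by (simp add: zero[OF order_trans] zero cong: conj_cong)
    also have "\<dots> \<longleftrightarrow> C = {x} \<or> C = {y, z}" (is "?L \<longleftrightarrow> ?R")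
    proof
      assume L: ?L
      show ?R
      proof (cases "x \<in> C")
        case True
        \<comment> \<open>\<open>{x}\<close> is itself a nonempty zero-sum subset of
          \<open>C\<close>, so minimality forces equality.\<close>
        then have "{x} = C" using L ne by (metis empty_not_insert empty_subsetI insert_subset singletonD)
        then show ?thesis by simp
      qed (use L in auto)
    next
      assume ?R
      then show ?L using ne by blast
    qed
    finally show ?thesis .
  qed
  then show ?thesis
    using that[of x y z] ne ground by (auto simp: IAS_matroid_def)
qed

text \<open>The only circuits are \<open>{x}\<close> and \<open>{y, z}\<close>, so they are also the
  classes; \<open>{x} \<noteq> {y, z}\<close> records that there are two of them.\<close>

lemma IAS_matroid_singleton_components:
  assumes "card (verts H) = 1"
  shows "\<exists>x y z. {x} \<noteq> {y, z} \<and>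
    matroid_components (IAS_matroid H) = {{x}, {y, z}} \<and>
    matroid_loop (IAS_matroid H) x \<and>
    \<not> matroid_loop (IAS_matroid H) y \<and> \<not> matroid_loop (IAS_matroid H) z \<and>
    matroid_parallel (IAS_matroid H) y z"
proof -
  obtain v where "verts H = {v}" using assms by (auto simp: card_1_singleton_iff)
  then obtain x y z where ne: "x \<noteq> y" "x \<noteq> z" "y \<noteq> z"
    and ground: "ground (IAS_matroid H) = {x, y, z}"
    and circ: "\<And>C. matroid_circuit (IAS_matroid H) C \<longleftrightarrow> C = {x} \<or> C = {y, z}"
    by (rule IAS_matroid_singleton) blast
  have "same_component (IAS_matroid H) = {(x, x), (y, y), (z, z), (y, z), (z, y)}"
    by (auto simp: same_component_def circ ground)
  then have "same_component (IAS_matroid H) `` {x} = {x}"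
    "same_component (IAS_matroid H) `` {y} = {y, z}"
    "same_component (IAS_matroid H) `` {z} = {y, z}"
    using ne by auto
  then have "matroid_components (IAS_matroid H) = {{x}, {y, z}}"
    by (simp add: matroid_components_def ground quotient_def insert_commute)
  moreover have "matroid_loop (IAS_matroid H) x" "matroid_parallel (IAS_matroid H) y z"
    using ne by (simp_all add: matroid_loop_def matroid_parallel_def circ)
  moreover have "\<not> matroid_loop (IAS_matroid H) y" "\<not> matroid_loop (IAS_matroid H) z"
    using ne by (auto simp: matroid_loop_def circ)
  moreover have "{x} \<noteq> {y, z}" using ne by blast
  ultimately show ?thesis by blast
qed

theorem theorem34:
  fixes G :: "('a, 'b) pre_digraph"
  assumes "looped_simple_graph G"
  shows "disjoint_family_on (\<lambda>H. ground (IAS_matroid H)) (graph_components G) \<and>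
    IAS_matroid G = direct_sum (graph_components G) IAS_matroid \<and>
    (\<forall>H \<in> graph_components G.
      (card (verts H) \<noteq> 1 \<longrightarrow> matroid_connected (IAS_matroid H)) \<and>
      (card (verts H) = 1 \<longrightarrow>
        (\<exists>x y z. {x} \<noteq> {y, z} \<and>
          matroid_components (IAS_matroid H) = {{x}, {y, z}} \<and>
          matroid_loop (IAS_matroid H) x \<and>
          \<not> matroid_loop (IAS_matroid H) y \<and> \<not> matroid_loop (IAS_matroid H) z \<and>
          matroid_parallel (IAS_matroid H) y z)))"
proof -
  interpret looped_simple_graph G by fact
  have pseudo: "pseudo_graph G" ..
  have comp: "(card (verts H) \<noteq> 1 \<longrightarrow> matroid_connected (IAS_matroid H))" if H: "H \<in> sccs" for H
  proof -
    \<comment> \<open>Being induced, a component inherits finiteness and symmetry from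
      \<open>G\<close>.\<close>
    have ind: "induced_subgraph H G" using H by (rule in_sccs_imp_induced)
    then have "fin_digraph H" "symmetric H"
      using fin_digraph_subgraph sym_arcs induced_graph_imp_symmetric by blast+
    then have "pseudo_graph H"
      by (simp add: pseudo_graph_def sym_digraph_def sym_digraph_axioms_def fin_digraph_def)
    moreover have "strongly_connected H" using H by blast
    ultimately show ?thesis using IAS_matroid_connected by blast
  qed
  show ?thesis
    using IAS_matroid_direct_sum_sccs[OF pseudo] comp IAS_matroid_singleton_components
    unfolding graph_components_eq_sccs by blast
qed

end
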